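(* Let $n\geq1$, $P_n=\{(i,j)\in[n]^2: i<j\}$ with $[n]=\{0,\ldots,n\}$, and $I\subset P_n$. Let $A_{I,n}$ be the set of total cyclic orders $\pi$ on $[n]$ such that $(i,i+1,\ldots,j)$ is a $\pi$-chain for every $(i,j)\in I$, and let $B_{I,n}=\{x\in[0,1]^n : x_{i+1}+\cdots+x_j\leq1 \text{ for all }(i,j)\in I\}$. Then \[ E^*(B_{I,n},z)=\sum_{\pi\in A_{I,n}} z^{\mathrm{des}(\underline{\pi})}. \]
   Context: A cyclic order on $X$ is a set $\pi\subset X^3$ with: (i) $(x,y,z)\in\pi\Rightarrow(y,z,x)\in\pi$; (ii) $(x,y,z)\in\pi\Rightarrow(z,y,x)\notin\pi$; (iii) $(x,y,z),(x,z,u)\in\pi\Rightarrow(x,y,u)\in\pi$; it is total if for all distinct $x,y,z$ either $(x,y,z)\in\pi$ or $(z,y,x)\in\pi$. For $m\geq3$, $(x_1,\ldots,x_m)$ (distinct elements) is a $\pi$-chain if $(x_1,x_i,x_{i+1})\in\pi$ for $2\leq i\leq m-1$; any pair of distinct elements is a $\pi$-chain. For a total cyclic order $\pi$ on $[n]$, $\underline{\pi}=(w_0,\ldots,w_n)$ is the unique word of distinct letters of $[n]$ with $w_0=0$ such that $(w_0,w_1,\ldots,w_n)$ is a $\pi$-chain (reading the elements around the circle clockwise starting from $0$). For such a word, $\mathrm{des}(\underline{w})$ is the number of positions $0\leq i\leq n-1$ with $w_{i+1}<w_i$. For a lattice polytope $P\subset\mathbb{R}^n$, $E(P,t)=\#(tP\cap\mathbb{Z}^n)$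 for integers $t\geq0$, and the Ehrhart $h^*$-polynomial is $E^*(P,z)=(1-z)^{n+1}\sum_{t\geq0}E(P,t)z^t$. *)

theory Defs
  imports Complex_Main "HOL-Library.FuncSet" "HOL-Computational_Algebra.Formal_Power_Series"
begin

definition cyclic_order_on :: "'a set \<Rightarrow> ('a \<times> 'a \<times> 'a) set \<Rightarrow> bool" where
  "cyclic_order_on X \<pi> \<longleftrightarrow>
     \<pi> \<subseteq> X \<times> X \<times> X \<and>
     (\<forall>x y z. (x, y, z) \<in> \<pi> \<longrightarrow> (y, z, x) \<in> \<pi>) \<and>
     (\<forall>x y z. (x, y, z) \<in> \<pi> \<longrightarrow> (z, y, x) \<notin> \<pi>) \<and>
     (\<forall>x y z u. (x, y, z) \<in> \<pi> \<and> (x, z, u) \<in> \<pi> \<longrightarrow> (x, y, u) \<in> \<pi>)"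

definition total_cyclic_order_on :: "'a set \<Rightarrow> ('a \<times> 'a \<times> 'a) set \<Rightarrow> bool" where
  "total_cyclic_order_on X \<pi> \<longleftrightarrow>
     cyclic_order_on X \<pi> \<and>
     (\<forall>x\<in>X. \<forall>y\<in>X. \<forall>z\<in>X. x \<noteq> y \<and> y \<noteq> z \<and> x \<noteq> z \<longrightarrow> (x, y, z) \<in> \<pi> \<or> (z, y, x) \<in> \<pi>)"

text \<open>For lists of length 2 the last condition is vacuous, so every pair of distinct
  elements is a chain.\<close>

definition cyclic_chain :: "'a set \<Rightarrow> ('a \<times> 'a \<times> 'a) set \<Rightarrow> 'a list \<Rightarrow> bool" where
  "cyclic_chain X \<pi> xs \<longleftrightarrow>
     2 \<le> length xs \<and> set xs \<subseteq> X \<and> distinct xs \<and>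
     (\<forall>i. 1 \<le> i \<and> i + 1 < length xs \<longrightarrow> (xs ! 0, xs ! i, xs ! (i + 1)) \<in> \<pi>)"

definition cyclic_word :: "nat \<Rightarrow> (nat \<times> nat \<times> nat) set \<Rightarrow> nat list" where
  "cyclic_word n \<pi> = (THE w. length w = n + 1 \<and> w ! 0 = 0 \<and> cyclic_chain {0..n} \<pi> w)"

definition des :: "nat list \<Rightarrow> nat" where
  "des w = card {i. i + 1 < length w \<and> w ! (i + 1) < w ! i}"

definition index_pairs :: "nat \<Rightarrow> (nat \<times> nat) set" where
  "index_pairs n = {(i, j). i \<in> {0..n} \<and> j \<in> {0..n} \<and> i < j}"

definition cyclic_orders_A :: "(nat \<times> nat) set \<Rightarrow> nat \<Rightarrow> (nat \<times> nat \<times> nat) set set" where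
  "cyclic_orders_A I n =
     {\<pi>. total_cyclic_order_on {0..n} \<pi> \<and> (\<forall>(i, j)\<in>I. cyclic_chain {0..n} \<pi> [i..<j + 1])}"

text \<open>Euclidean \<open>n\<close>-space, with \<open>n\<close> a term, is represented by the extensional functions
  \<open>{1..n} \<rightarrow>\<^sub>E UNIV\<close>; the lattice of integer points is then \<open>{1..n} \<rightarrow>\<^sub>E \<int>\<close>.\<close>

definition polytope_B :: "(nat \<times> nat) set \<Rightarrow> nat \<Rightarrow> (nat \<Rightarrow> real) set" where
  "polytope_B I n =
     {x \<in> {1..n} \<rightarrow>\<^sub>E {0..1}. \<forall>(i, j)\<in>I. (\<Sum>k=i+1..j. x k) \<le> 1}"

definition dilate :: "nat \<Rightarrow> nat \<Rightarrow> (nat \<Rightarrow> real) set \<Rightarrow> (nat \<Rightarrow> real) set" where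
  "dilate n t P = (\<lambda>x. \<lambda>k\<in>{1..n}. real t * x k) ` P"

definition ehrhart :: "nat \<Rightarrow> (nat \<Rightarrow> real) set \<Rightarrow> nat \<Rightarrow> nat" where
  "ehrhart n P t = card (dilate n t P \<inter> ({1..n} \<rightarrow>\<^sub>E \<int>))"

definition ehrhart_hstar :: "nat \<Rightarrow> (nat \<Rightarrow> real) set \<Rightarrow> int fps" where
  "ehrhart_hstar n P = (1 - fps_X) ^ (n + 1) * Abs_fps (\<lambda>t. int (ehrhart n P t))"

end

theory Submission
  imports Defs
begin

text \<open>A lattice point \<open>x\<close> of \<open>t [0,1]\<^sup>n\<close> is a walk \<open>f k = x 1 + \<dots> + x k mod (t + 1)\<close> on a circle with
  \<open>t + 1\<close> points starting at \<open>0\<close>. Ordering \<open>0, \<dots>, n\<close> lexicographically by \<open>(f k, k)\<close> and closing up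
  gives a total cyclic order \<open>\<pi>\<close>, and \<open>x (i + 1) + \<dots> + x j \<le> t\<close> says that the walk does not come
  full circle between times \<open>i\<close> and \<open>j\<close>, i.e. that \<open>i, \<dots>, j\<close> is a \<open>\<pi>\<close>-chain. The walks that
  give a fixed \<open>\<pi>\<close> with word \<open>w\<close> are the sequences \<open>0 = f (w 0) \<le> \<dots> \<le> f (w n) \<le> t\<close> that are
  strict at the descents of \<open>w\<close>, and these have generating function \<open>z ^ des w / (1 - z) ^ (n + 1)\<close>.\<close>

section \<open>Cyclic orders induced by injective labellings\<close>

definition cyclic_order_of :: "'a set \<Rightarrow> ('a \<Rightarrow> nat) \<Rightarrow> ('a \<times> 'a \<times> 'a) set" where
  "cyclic_order_of X p = {(x, y, z). x \<in> X \<and> y \<in> X \<and> z \<in> X \<and>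
     (p x < p y \<and> p y < p z \<or> p y < p z \<and> p z < p x \<or> p z < p x \<and> p x < p y)}"

text \<open>Rotating the labels does not change the cyclic order; placing \<open>0\<close> lowest
  fixes the cut at the point where words start.\<close>

definition zero_first :: "nat \<Rightarrow> (nat \<Rightarrow> nat) \<Rightarrow> bool" where
  "zero_first n p \<longleftrightarrow> inj_on p {0..n} \<and> (\<forall>k\<in>{1..n}. p 0 < p k)"

lemma total_cyclic_order_of:
  assumes "inj_on p X"
  shows "total_cyclic_order_on X (cyclic_order_of X p)"
proof -
  have "p x \<noteq> p y" if "x \<in> X" "y \<in> X" "x \<noteq> y" for x y
    using assms that by (auto dest: inj_onD)
  then have "\<forall>x\<in>X. \<forall>y\<in>X. \<forall>z\<in>X. x \<noteq> y \<and> y \<noteq> z \<and> x \<noteq> z \<longrightarrow>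
      (x, y, z) \<in> cyclic_order_of X p \<or> (z, y, x) \<in> cyclic_order_of X p"
    unfolding cyclic_order_of_def by simp (metis linorder_neqE_nat)
  moreover have "cyclic_order_on X (cyclic_order_of X p)"
    unfolding cyclic_order_on_def cyclic_order_of_def by (intro conjI) auto
  ultimately show ?thesis
    by (simp add: total_cyclic_order_on_def)
qed

text \<open>Totality makes cyclic orders maximal: a triple of \<open>\<pi>\<close> missing from
  \<open>\<sigma>\<close> would have its reversal in \<open>\<sigma>\<close>, hence in
  \<open>\<pi>\<close>, against asymmetry.\<close>

lemma total_cyclic_order_subset_eq:
  assumes "total_cyclic_order_on X \<sigma>" "total_cyclic_order_on X \<pi>" "\<sigma> \<subseteq> \<pi>"
  shows "\<sigma> = \<pi>"
proof (rule antisym[OF assms(3)], rule subrelI)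
  fix x yz assume xyz: "(x, yz) \<in> \<pi>"
  obtain y z where yz: "yz = (y, z)" by (cases yz)
  have cyc: "\<And>x y z. (x, y, z) \<in> \<pi> \<Longrightarrow> (y, z, x) \<in> \<pi>"
    and asym: "\<And>x y z. (x, y, z) \<in> \<pi> \<Longrightarrow> (z, y, x) \<notin> \<pi>"
    and sub: "\<pi> \<subseteq> X \<times> X \<times> X"
    using assms(2) unfolding total_cyclic_order_on_def cyclic_order_on_def by blast+
  \<comment> \<open>A triple with a repeated entry has a rotation that is its own reversal, which
    asymmetry forbids.\<close>
  have "x \<noteq> y" "y \<noteq> z" "x \<noteq> z"
    using xyz cyc asym unfolding yz by metis+
  moreover have "x \<in> X" "y \<in> X" "z \<in> X"
    using xyz sub unfolding yz by auto
  ultimately have "(x, y, z) \<in> \<sigma> \<or> (z, y, x) \<in> \<sigma>"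
    using assms(1) unfolding total_cyclic_order_on_def by blast
  then show "(x, yz) \<in> \<sigma>"
    using xyz asym assms(3) unfolding yz by blast
qed

text \<open>The label of \<open>y\<close> is its rank in the linear order obtained by cutting the circle at \<open>0\<close>.\<close>

lemma total_cyclic_order_labelling:
  assumes "total_cyclic_order_on {0..n} \<pi>"
  obtains p where "zero_first n p" "\<pi> = cyclic_order_of {0..n} p"
proof -
  have cyc: "\<And>x y z. (x, y, z) \<in> \<pi> \<Longrightarrow> (y, z, x) \<in> \<pi>"
    and asym: "\<And>x y z. (x, y, z) \<in> \<pi> \<Longrightarrow> (z, y, x) \<notin> \<pi>"
    and trans: "\<And>x y z u. (x, y, z) \<in> \<pi> \<Longrightarrow> (x, z, u) \<in> \<pi> \<Longrightarrow> (x, y, u) \<in> \<pi>"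
    and sub: "\<pi> \<subseteq> {0..n} \<times> {0..n} \<times> {0..n}"
    and tot: "\<And>x y z. x \<in> {0..n} \<Longrightarrow> y \<in> {0..n} \<Longrightarrow> z \<in> {0..n} \<Longrightarrow> x \<noteq> y \<Longrightarrow> y \<noteq> z \<Longrightarrow>
        x \<noteq> z \<Longrightarrow> (x, y, z) \<in> \<pi> \<or> (z, y, x) \<in> \<pi>"
    using assms unfolding total_cyclic_order_on_def cyclic_order_on_def by blast+
  \<comment> \<open>The \<open>Suc\<close> leaves label 0 to the element \<open>0\<close> alone,
    since for the clockwise neighbour of \<open>0\<close> the counted set is empty.\<close>
  define p where "p y = (if y = 0 then 0 else Suc (card {x. (0, x, y) \<in> \<pi>}))" for y :: nat
  have mono: "p y < p z" if "(0, y, z) \<in> \<pi>" for y z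
  proof -
    have "y \<noteq> 0" "z \<noteq> 0"
      using that cyc asym by metis+
    have "finite {x. (0, x, z) \<in> \<pi>}"
      by (rule finite_subset[of _ "{0..n}"]) (use sub in auto)
    \<comment> \<open>The inclusion is transitivity; it is proper because \<open>y\<close> lies only
      in the larger set.\<close>
    moreover have "{x. (0, x, y) \<in> \<pi>} \<subset> {x. (0, x, z) \<in> \<pi>}"
      using that trans cyc asym by blast
    ultimately show ?thesis
      using \<open>y \<noteq> 0\<close> \<open>z \<noteq> 0\<close> by (simp add: p_def psubset_card_mono)
  qed
  have less: "(0, y, z) \<in> \<pi>" if "p y < p z" "y \<in> {1..n}" "z \<in> {1..n}" for y z
  proof (rule ccontr)
    assume "(0, y, z) \<notin> \<pi>"
    then have "(z, y, 0) \<in> \<pi>"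
      using tot[of 0 y z] that by auto
    then have "p z < p y" by (metis cyc mono)
    then show False using that by simp
  qed
  have p0: "p 0 = 0" "\<And>y. p y = 0 \<Longrightarrow> y = 0" by (auto simp: p_def split: if_splits)
  have "y = z" if "y \<in> {0..n}" "z \<in> {0..n}" "p y = p z" for y z
  proof (rule ccontr)
    assume "y \<noteq> z"
    then have "y \<noteq> 0" "z \<noteq> 0" using that p0 by metis+
    then have "(0, y, z) \<in> \<pi> \<or> (z, y, 0) \<in> \<pi>"
      using tot[of 0 y z] that \<open>y \<noteq> z\<close> by auto
    then have "p y < p z \<or> p z < p y" by (metis cyc mono)
    then show False using that by simp
  qed
  then have inj: "inj_on p {0..n}" by (auto intro: inj_onI)
  then have zf: "zero_first n p"
    by (auto simp: zero_first_def p_def)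
  have triple: "(x, y, z) \<in> \<pi>" if "p x < p y" "p y < p z" "x \<in> {0..n}" "y \<in> {0..n}" "z \<in> {0..n}" for x y z
  proof (cases "x = 0")
    case True
    have "y \<noteq> 0" "z \<noteq> 0" using that p0 by (metis not_less_zero)+
    then show ?thesis using less[of y z] that True by auto
  next
    case False
    have "y \<noteq> 0" "z \<noteq> 0" using that p0 by (metis not_less_zero)+
    then have "(0, x, y) \<in> \<pi>" "(0, y, z) \<in> \<pi>"
      using less[of y z] less[of x y] that False by auto
    \<comment> \<open>Transitivity based at \<open>y\<close>: the two triples rotate to
      \<open>(y, z, 0)\<close> and \<open>(y, 0, x)\<close>.\<close>
    then have "(y, z, x) \<in> \<pi>" by (metis cyc trans)
    then show ?thesis by (metis cyc)
  qed
  \<comment> \<open>One inclusion suffices as both orders are total, and each triple on the left is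
    a rotation of one with increasing labels.\<close>
  have "cyclic_order_of {0..n} p \<subseteq> \<pi>"
  proof (rule subsetI)
    fix u assume "u \<in> cyclic_order_of {0..n} p"
    then obtain x y z where u: "u = (x, y, z)" "x \<in> {0..n}" "y \<in> {0..n}" "z \<in> {0..n}"
      and d: "p x < p y \<and> p y < p z \<or> p y < p z \<and> p z < p x \<or> p z < p x \<and> p x < p y"
      unfolding cyclic_order_of_def by blast
    from d have "(x, y, z) \<in> \<pi> \<or> (y, z, x) \<in> \<pi> \<or> (z, x, y) \<in> \<pi>"
      using triple u(2-4) by blast
    then show "u \<in> \<pi>" unfolding u(1) by (metis cyc)
  qed
  then have "\<pi> = cyclic_order_of {0..n} p"
    using total_cyclic_order_subset_eq[OF total_cyclic_order_of[OF inj] assms] by simp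
  with zf show ?thesis by (rule that)
qed

section \<open>Words of cyclic orders as sorted lists\<close>

text \<open>Since \<open>0\<close> has the least label, a triple \<open>(0, y, z)\<close> with
  nonzero \<open>y\<close> and \<open>z\<close> is in the order exactly when
  \<open>p y < p z\<close>, so being a chain is sortedness of neighbours. A word of
  \<open>n + 1\<close> distinct letters must use all of \<open>{0..n}\<close>.\<close>

lemma chain_iff_sorted:
  assumes "zero_first n p" and n: "n \<ge> 1"
  shows "length w = n + 1 \<and> w ! 0 = 0 \<and> cyclic_chain {0..n} (cyclic_order_of {0..n} p) w \<longleftrightarrow>
    set w = {0..n} \<and> sorted_wrt (<) (map p w)" (is "?L \<longleftrightarrow> ?R")
proof
  assume L: ?L
  then have d: "distinct w" and l: "length w = n + 1" and w0: "w ! 0 = 0" and s: "set w \<subseteq> {0..n}"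
    and c: "\<And>i. 1 \<le> i \<Longrightarrow> i + 1 < length w \<Longrightarrow> (0, w ! i, w ! (i + 1)) \<in> cyclic_order_of {0..n} p"
    unfolding cyclic_chain_def by auto
  have "card (set w) = card {0..n}" using d l by (simp add: distinct_card)
  then have set: "set w = {0..n}" using s by (simp add: card_subset_eq)
  have zero: "p 0 < p (w ! i)" if "1 \<le> i" "i < length w" for i
  proof -
    have "w ! i \<noteq> w ! 0" using nth_eq_iff_index_eq[OF d that(2), of 0] that l by simp
    moreover have "w ! i \<in> {0..n}" using that set nth_mem by blast
    ultimately show ?thesis using assms w0 by (auto simp: zero_first_def)
  qed
  \<comment> \<open>The chain condition starts at \<open>i = 1\<close>; the first comparison holds
    because \<open>0\<close> has the least label.\<close>
  have "p (w ! i) < p (w ! Suc i)" if "Suc i < length w" for i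
  proof (cases "i = 0")
    case True
    then show ?thesis using zero[of 1] that w0 by simp
  next
    case False
    then show ?thesis using c[of i] zero[of i] zero[of "Suc i"] that
      by (auto simp: cyclic_order_of_def)
  qed
  then have "sorted_wrt (<) (map p w)"
    by (subst sorted_wrt_iff_nth_Suc_transp) auto
  with set L show ?R by simp
next
  assume R: ?R
  then have st: "sorted_wrt (<) (map p w)" and set: "set w = {0..n}" by auto
  have "distinct (map p w)" using st by (simp add: strict_sorted_iff)
  then have d: "distinct w" by (simp add: distinct_map)
  then have l: "length w = n + 1" using set distinct_card by fastforce
  have lt: "p (w ! i) < p (w ! j)" if "i < j" "j < length w" for i j
    using sorted_wrt_nth_less[OF st, of i j] that by simp
  obtain i where i: "i < length w" "w ! i = 0" using set by (metis atLeastAtMost_iff in_set_conv_nth le0)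
  have w0: "w ! 0 = 0"
  proof (rule ccontr)
    assume a: "w ! 0 \<noteq> 0"
    then have "i > 0" using i by (metis gr0I)
    then have "p (w ! 0) < p 0" using lt[of 0 i] i by simp
    moreover have "w ! 0 \<in> {1..n}" using set l nth_mem[of 0 w] a by auto
    ultimately show False using assms unfolding zero_first_def by (meson less_asym)
  qed
  have "(w ! 0, w ! i, w ! (i + 1)) \<in> cyclic_order_of {0..n} p" if "1 \<le> i" "i + 1 < length w" for i
  proof -
    have "w ! 0 \<in> {0..n}" "w ! i \<in> {0..n}" "w ! (i + 1) \<in> {0..n}"
      using that set nth_mem[of 0 w] nth_mem[of i w] nth_mem[of "i+1" w] l by auto
    then show ?thesis using lt[of 0 i] lt[of i "i + 1"] that by (simp add: cyclic_order_of_def)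
  qed
  then show ?L using l w0 d set n by (auto simp: cyclic_chain_def)
qed

text \<open>Resolves the definite description in \<open>cyclic_word\<close>: by the equivalence
  above, a candidate lists \<open>{0..n}\<close> by increasing label, and sorting produces the only
  such list.\<close>

lemma cyclic_word_cyclic_order_of:
  assumes "zero_first n p" "n \<ge> 1"
  shows "set (cyclic_word n (cyclic_order_of {0..n} p)) = {0..n}"
    and "sorted_wrt (<) (map p (cyclic_word n (cyclic_order_of {0..n} p)))"
proof -
  have inj: "inj_on p {0..n}" using assms by (simp add: zero_first_def)
  define w0 where "w0 = sort_key p [0..<n + 1]"
  have setw0: "set w0 = {0..n}" by (auto simp: w0_def)
  have sw0: "sorted_wrt (<) (map p w0)"
    using inj setw0 by (simp add: strict_sorted_iff distinct_map w0_def)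
  have uniq: "w = w0" if "set w = {0..n}" "sorted_wrt (<) (map p w)" for w
  proof -
    have "map p w = map p w0"
      using that sw0 setw0 by (intro strict_sorted_equal) auto
    then show ?thesis
      using inj that(1) setw0 by (intro map_inj_on[of p w w0]) auto
  qed
  have "cyclic_word n (cyclic_order_of {0..n} p) = w0"
    unfolding cyclic_word_def
  proof (rule the_equality)
    show "length w0 = n + 1 \<and> w0 ! 0 = 0 \<and> cyclic_chain {0..n} (cyclic_order_of {0..n} p) w0"
      using chain_iff_sorted[OF assms, of w0] setw0 sw0 by blast
  next
    fix w assume "length w = n + 1 \<and> w ! 0 = 0 \<and> cyclic_chain {0..n} (cyclic_order_of {0..n} p) w"
    then show "w = w0"
      using chain_iff_sorted[OF assms, of w] uniq by blast
  qed
  with setw0 sw0 show "set (cyclic_word n (cyclic_order_of {0..n} p)) = {0..n}"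
    "sorted_wrt (<) (map p (cyclic_word n (cyclic_order_of {0..n} p)))" by simp_all
qed

text \<open>Both labellings compare two letters by their positions in \<open>w\<close>, and only
  comparisons enter the cyclic order.\<close>

lemma cyclic_order_of_eqI:
  assumes "sorted_wrt (<) (map p w)" "sorted_wrt (<) (map q w)"
  shows "cyclic_order_of (set w) p = cyclic_order_of (set w) q"
proof -
  have "r (w ! a) < r (w ! b) \<longleftrightarrow> a < b"
    if r: "sorted_wrt (<) (map r w)" and "a < length w" "b < length w" for r :: "_ \<Rightarrow> nat" and a b
    using sorted_wrt_nth_less[OF r, of a b] sorted_wrt_nth_less[OF r, of b a] that
    by (cases a b rule: linorder_cases) auto
  then have "p x < p y \<longleftrightarrow> q x < q y" if "x \<in> set w" "y \<in> set w" for x y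
    using assms that by (metis in_set_conv_nth)
  then show ?thesis
    unfolding cyclic_order_of_def by auto
qed

lemma sorted_wrt_cong_on_set:
  assumes "\<And>x y. x \<in> set w \<Longrightarrow> y \<in> set w \<Longrightarrow> P x y \<longleftrightarrow> Q x y"
  shows "sorted_wrt P w \<longleftrightarrow> sorted_wrt Q w"
  using assms sorted_wrt_mono_rel[of w P Q] sorted_wrt_mono_rel[of w Q P] by blast

section \<open>Lexicographic sorting of lattice points\<close>

text \<open>Breaking ties by index admits equal values at neighbouring letters precisely when the
  letters ascend; this is how descents enter.\<close>

definition lex_less :: "(nat \<Rightarrow> nat) \<Rightarrow> nat \<Rightarrow> nat \<Rightarrow> bool" where
  "lex_less f x y \<longleftrightarrow> f x < f y \<or> f x = f y \<and> x < y"

text \<open>Encodes the pair \<open>(f k, k)\<close> in one number: for \<open>k \<le> n\<close>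
  these are quotient and remainder modulo \<open>n + 1\<close>.\<close>

definition lex_key :: "nat \<Rightarrow> (nat \<Rightarrow> nat) \<Rightarrow> nat \<Rightarrow> nat" where
  "lex_key n f k = f k * (n + 1) + k"

lemma lex_key_less_iff:
  assumes "x \<le> n" "y \<le> n"
  shows "lex_key n f x < lex_key n f y \<longleftrightarrow> lex_less f x y"
proof -
  have *: "lex_key n f x < lex_key n f y" if "f x < f y" "x \<le> n" for x y
  proof -
    have "Suc (f x) * (n + 1) \<le> f y * (n + 1)" using that by (intro mult_right_mono) auto
    then show ?thesis using that by (simp add: lex_key_def)
  qed
  show ?thesis
    using *[of x y] *[of y x] assms
    by (cases "f x" "f y" rule: linorder_cases) (auto simp: lex_less_def lex_key_def)
qed

lemma zero_first_lex_key:
  assumes "f 0 = 0"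
  shows "zero_first n (lex_key n f)"
  unfolding zero_first_def
proof
  show "inj_on (lex_key n f) {0..n}"
  proof (rule linorder_inj_onI)
    fix x y assume "x < y" "x \<in> {0..n}" "y \<in> {0..n}"
    then have "lex_key n f x < lex_key n f y \<or> lex_key n f y < lex_key n f x"
      by (auto simp: lex_key_less_iff lex_less_def)
    then show "lex_key n f x \<noteq> lex_key n f y" by auto
  qed auto
qed (use assms in \<open>auto simp: lex_key_def\<close>)

section \<open>Counting sorted maps by descents\<close>

text \<open>Any list \<open>w\<close> is allowed, so that the count can proceed by removing the last
  letter.\<close>

definition lex_sorted_maps :: "nat list \<Rightarrow> nat \<Rightarrow> (nat \<Rightarrow> nat) set" where
  "lex_sorted_maps w t = {f \<in> set w \<rightarrow>\<^sub>E {0..t}. f (hd w) = 0 \<and> sorted_wrt (lex_less f) w}"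

lemma finite_lex_sorted_maps: "finite (lex_sorted_maps w t)"
  unfolding lex_sorted_maps_def
  by (rule finite_subset[OF _ finite_PiE[of "set w" "\<lambda>_. {0..t}"]]) auto

lemma des_snoc:
  assumes "w \<noteq> []"
  shows "des (w @ [y]) = des w + (if y < last w then 1 else 0)"
proof -
  obtain m where m: "length w = Suc m" using assms by (cases w) auto
  \<comment> \<open>Only position \<open>m\<close>, that of the last letter of \<open>w\<close>, can
    become a new descent.\<close>
  have "{i. i + 1 < length (w @ [y]) \<and> (w @ [y]) ! (i + 1) < (w @ [y]) ! i} =
    {i. i + 1 < length w \<and> w ! (i + 1) < w ! i} \<union> (if y < last w then {m} else {})"
    using m assms by (auto simp: nth_append last_conv_nth less_Suc_eq split: if_splits)
  moreover have "m \<notin> {i. i + 1 < length w \<and> w ! (i + 1) < w ! i}" using m by simp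
  moreover have "finite {i. i + 1 < length w \<and> w ! (i + 1) < w ! i}"
    by (rule finite_subset[of _ "{..length w}"]) auto
  ultimately show ?thesis by (auto simp: des_def)
qed

text \<open>Fix the value \<open>a\<close> at the new letter. The earlier values are bounded by
  \<open>a\<close>, and by \<open>a - 1\<close> if \<open>y < last w\<close>, where a tie would be
  in the wrong order. The case \<open>a = 0\<close> is separate because truncated subtraction would
  not give an empty range.\<close>

lemma lex_sorted_maps_snoc:
  assumes "w \<noteq> []" "y \<notin> set w"
  shows "bij_betw (\<lambda>(a, f). f(y := a))
    (SIGMA a:{0..t}. if y < last w then (if a = 0 then {} else lex_sorted_maps w (a - 1)) else lex_sorted_maps w a)
    (lex_sorted_maps (w @ [y]) t)" (is "bij_betw ?h ?S ?T")
proof -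
  have upd: "sorted_wrt (lex_less (f(y := a))) w = sorted_wrt (lex_less f) w" for f a
    using assms(2) by (intro sorted_wrt_cong_on_set) (auto simp: lex_less_def)
  \<comment> \<open>The last letter carries the lexicographically greatest pair, so comparing it
    with \<open>y\<close> controls all letters.\<close>
  have last: "f x \<le> f (last w) \<and> (f x = f (last w) \<longrightarrow> x \<le> last w)"
    if "sorted_wrt (lex_less f) w" "x \<in> set w" for f x
  proof (cases "x = last w")
    case False
    have "w = butlast w @ [last w]" using assms(1) by simp
    then have "sorted_wrt (lex_less f) (butlast w @ [last w])" "x \<in> set (butlast w @ [last w])"
      using that by metis+
    then show ?thesis using False by (auto simp: sorted_wrt_append lex_less_def)
  qed simp
  have lw: "last w \<in> set w" "hd w \<in> set w" using assms(1) by auto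
  have fwd: "f(y := a) \<in> ?T" if "(a, f) \<in> ?S" for a f
  proof -
    \<comment> \<open>The bound left for the earlier letters; a descent costs one unit.\<close>
    define b where "b = (if y < last w then a - 1 else a)"
    have f: "f \<in> lex_sorted_maps w b" and a: "a \<le> t" and b: "y < last w \<Longrightarrow> b < a" "b \<le> a"
      using that by (auto simp: b_def split: if_splits)
    have fb: "f x \<le> b" if "x \<in> set w" for x
      using f that by (auto simp: lex_sorted_maps_def PiE_def Pi_def)
    have s: "sorted_wrt (lex_less f) w" using f by (simp add: lex_sorted_maps_def)
    have "lex_less (f(y := a)) x y" if "x \<in> set w" for x
    proof (cases "y < last w")
      case True
      then show ?thesis using fb[OF that] b that assms(2) by (auto simp: lex_less_def)
    next
      case False
      have "last w \<noteq> y" using lw assms(2) by auto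
      then show ?thesis
        using False fb[OF that] fb[OF lw(1)] b last[OF s that] that assms(2) by (auto simp: lex_less_def b_def)
    qed
    moreover have "f(y := a) \<in> set (w @ [y]) \<rightarrow>\<^sub>E {0..t}"
      using f a order_trans[OF fb order_trans[OF b(2) a]]
      by (auto simp: lex_sorted_maps_def PiE_def Pi_def extensional_def)
    moreover have "hd w \<noteq> y" using lw assms(2) by auto
    ultimately show ?thesis
      using f assms(1) upd by (auto simp: lex_sorted_maps_def sorted_wrt_append)
  qed
  have bwd: "(g y, g(y := undefined)) \<in> ?S" if g: "g \<in> ?T" for g
  proof -
    have s: "sorted_wrt (lex_less g) w" and l: "\<And>x. x \<in> set w \<Longrightarrow> lex_less g x y"
      and e: "g \<in> set (w @ [y]) \<rightarrow>\<^sub>E {0..t}" and h: "g (hd w) = 0"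
      using g assms(1) by (auto simp: lex_sorted_maps_def sorted_wrt_append)
    have "hd w \<noteq> y" using lw assms(2) by auto
    then have m: "g(y := undefined) \<in> lex_sorted_maps w c" if "g (last w) \<le> c" for c
      using e h s upd last[OF s] that assms(2)
      by (fastforce simp: lex_sorted_maps_def PiE_def Pi_def extensional_def)
    have "g y \<in> {0..t}" using e by auto
    moreover have "g (last w) \<le> g y" "y < last w \<Longrightarrow> g (last w) < g y"
      using l[OF lw(1)] by (auto simp: lex_less_def)
    ultimately show ?thesis
      using m[of "g y"] m[of "g y - 1"] by auto
  qed
  \<comment> \<open>Hence resetting \<open>y\<close> to \<open>undefined\<close> recovers
    \<open>f\<close> from \<open>f(y := a)\<close>.\<close>
  have und: "f y = undefined" if "(a, f) \<in> ?S" for a f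
    using that assms(2) by (auto simp: lex_sorted_maps_def PiE_def extensional_def split: if_splits)
  show ?thesis
  proof (rule bij_betwI[where g = "\<lambda>g. (g y, g(y := undefined))"])
    show "?h \<in> ?S \<rightarrow> ?T" using fwd by auto
    show "(\<lambda>g. (g y, g(y := undefined))) \<in> ?T \<rightarrow> ?S" using bwd by blast
    show "(?h u y, (?h u)(y := undefined)) = u" if "u \<in> ?S" for u
      using und[of "fst u" "snd u"] that by (cases u) (auto simp: fun_upd_idem)
  qed auto
qed

text \<open>Multiplying by \<open>1 - fps_X\<close> takes successive differences, which undoes
  summation.\<close>

lemma one_minus_fps_X_mult_partial_sums:
  fixes c :: "nat \<Rightarrow> 'a::comm_ring_1"
  shows "(1 - fps_X) * Abs_fps (\<lambda>t. \<Sum>a\<in>{0..t}. c a) = Abs_fps c"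
proof (rule fps_ext)
  fix t
  show "fps_nth ((1 - fps_X) * Abs_fps (\<lambda>t. \<Sum>a\<in>{0..t}. c a)) t = fps_nth (Abs_fps c) t"
    by (cases t) (simp_all add: left_diff_distrib)
qed

text \<open>Induction on the last letter: summing over its value contributes a factor
  \<open>1 / (1 - z)\<close>, and a descent delays the summands by one, contributing
  \<open>z\<close>.\<close>

lemma lex_sorted_maps_fps:
  assumes "w \<noteq> []" "distinct w"
  shows "(1 - fps_X) ^ length w * Abs_fps (\<lambda>t. int (card (lex_sorted_maps w t))) = fps_X ^ des w"
  using assms
proof (induction w rule: rev_nonempty_induct)
  case (single x)
  have "lex_sorted_maps [x] t = {(\<lambda>k. undefined)(x := 0)}" for t
    by (auto simp: lex_sorted_maps_def PiE_def extensional_def fun_eq_iff)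
  \<comment> \<open>The constant 1 is written as the partial sums of the indicator of 0, whose
    series is 1.\<close>
  then have "(\<lambda>t. int (card (lex_sorted_maps [x] t))) = (\<lambda>t. \<Sum>a\<in>{0..t}. if a = 0 then 1 else 0)"
    by (auto simp: fun_eq_iff)
  moreover have "Abs_fps (\<lambda>a. if a = 0 then 1 else 0 :: int) = 1"
    by (rule fps_ext) simp
  ultimately show ?case
    by (simp only: one_minus_fps_X_mult_partial_sums length_Cons list.size power_Suc power_0 mult_1_right)
      (simp add: des_def)
next
  case (snoc y w)
  let ?F = "Abs_fps (\<lambda>t. int (card (lex_sorted_maps w t)))"
  define c where "c a = (if y < last w then (if a = 0 then 0 else int (card (lex_sorted_maps w (a - 1))))
    else int (card (lex_sorted_maps w a)))" for a
  have "int (card (lex_sorted_maps (w @ [y]) t)) = (\<Sum>a\<in>{0..t}. c a)" for t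
  proof -
    have "card (lex_sorted_maps (w @ [y]) t) = card (SIGMA a:{0..t}. if y < last w
        then (if a = 0 then {} else lex_sorted_maps w (a - 1)) else lex_sorted_maps w a)"
      using snoc by (intro bij_betw_same_card[symmetric, OF lex_sorted_maps_snoc]) auto
    also have "\<dots> = (\<Sum>a\<in>{0..t}. card (if y < last w
        then (if a = 0 then {} else lex_sorted_maps w (a - 1)) else lex_sorted_maps w a))"
      by (rule card_SigmaI) (auto simp: finite_lex_sorted_maps)
    also have "int \<dots> = (\<Sum>a\<in>{0..t}. c a)"
      unfolding of_nat_sum by (intro sum.cong) (auto simp: c_def)
    finally show ?thesis .
  qed
  then have "(1 - fps_X) * Abs_fps (\<lambda>t. int (card (lex_sorted_maps (w @ [y]) t))) = Abs_fps c"
    by (simp add: one_minus_fps_X_mult_partial_sums)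
  \<comment> \<open>At a descent \<open>c\<close> is the counting sequence of \<open>w\<close>
    delayed by one place, which is multiplication by \<open>fps_X\<close>.\<close>
  also have "\<dots> = fps_X ^ (if y < last w then 1 else 0) * ?F"
    by (rule fps_ext) (auto simp: c_def)
  finally have step: "(1 - fps_X) * Abs_fps (\<lambda>t. int (card (lex_sorted_maps (w @ [y]) t))) =
      fps_X ^ (if y < last w then 1 else 0) * ?F" .
  have "(1 - fps_X) ^ length (w @ [y]) * Abs_fps (\<lambda>t. int (card (lex_sorted_maps (w @ [y]) t)))
      = (1 - fps_X) ^ length w * ((1 - fps_X) * Abs_fps (\<lambda>t. int (card (lex_sorted_maps (w @ [y]) t))))"
    by (simp only: length_append_singleton power_Suc2 mult.assoc)
  also have "\<dots> = fps_X ^ (if y < last w then 1 else 0) * ((1 - fps_X) ^ length w * ?F)"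
    unfolding step by (rule mult.left_commute)
  also have "\<dots> = fps_X ^ des (w @ [y])"
    using snoc by (simp add: des_snoc)
  finally show ?case .
qed

section \<open>Lattice points of the dilated polytope\<close>

text \<open>Clockwise distance on a circle with \<open>t + 1\<close> points. Working modulo \<open>t + 1\<close> rather than \<open>t\<close>
  makes the steps \<open>0, \<dots>, t\<close> pairwise distinct.\<close>

definition circle_dist :: "nat \<Rightarrow> nat \<Rightarrow> nat \<Rightarrow> nat" where
  "circle_dist t a b = (if a \<le> b then b - a else b + t + 1 - a)"

definition circle_maps :: "nat \<Rightarrow> nat \<Rightarrow> (nat \<Rightarrow> nat) set" where
  "circle_maps n t = {f \<in> {0..n} \<rightarrow>\<^sub>E {0..t}. f 0 = 0}"

definition steps :: "nat \<Rightarrow> nat \<Rightarrow> (nat \<Rightarrow> nat) \<Rightarrow> nat \<Rightarrow> real" where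
  "steps n t f = (\<lambda>k\<in>{1..n}. real (circle_dist t (f (k - 1)) (f k)))"

lemma finite_circle_maps: "finite (circle_maps n t)"
  unfolding circle_maps_def by (rule finite_subset[OF _ finite_PiE[of "{0..n}" "\<lambda>_. {0..t}"]]) auto

lemma circle_maps_le: "f \<in> circle_maps n t \<Longrightarrow> k \<le> n \<Longrightarrow> f k \<le> t"
  by (auto simp: circle_maps_def PiE_def Pi_def)

text \<open>Serves the induction on \<open>j\<close> below: all triples of a chain start at its
  first element, so lengthening it adds only one triple.\<close>

lemma chain_Suc_iff:
  assumes "i < j"
  shows "cyclic_chain X \<pi> [i..<Suc j + 1] \<longleftrightarrow>
    cyclic_chain X \<pi> [i..<j + 1] \<and> Suc j \<in> X \<and> (i, j, Suc j) \<in> \<pi>"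
proof -
  have nth: "[i..<m] ! k = i + k" if "i + k < m" for k m using that by simp
  have "(\<forall>k. 1 \<le> k \<and> k + 1 < length [i..<Suc j + 1] \<longrightarrow>
        ([i..<Suc j + 1] ! 0, [i..<Suc j + 1] ! k, [i..<Suc j + 1] ! (k + 1)) \<in> \<pi>) \<longleftrightarrow>
      (\<forall>k. 1 \<le> k \<and> k < Suc j - i \<longrightarrow> (i, i + k, i + k + 1) \<in> \<pi>)"
    using assms by (auto simp: nth simp del: upt_Suc)
  moreover have "(\<forall>k. 1 \<le> k \<and> k + 1 < length [i..<j + 1] \<longrightarrow>
        ([i..<j + 1] ! 0, [i..<j + 1] ! k, [i..<j + 1] ! (k + 1)) \<in> \<pi>) \<longleftrightarrow>
      (\<forall>k. 1 \<le> k \<and> k < j - i \<longrightarrow> (i, i + k, i + k + 1) \<in> \<pi>)"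
    using assms by (auto simp: nth simp del: upt_Suc)
  moreover have "(\<forall>k. 1 \<le> k \<and> k < Suc j - i \<longrightarrow> (i, i + k, i + k + 1) \<in> \<pi>) \<longleftrightarrow>
      (\<forall>k. 1 \<le> k \<and> k < j - i \<longrightarrow> (i, i + k, i + k + 1) \<in> \<pi>) \<and> (i, j, Suc j) \<in> \<pi>"
  proof -
    have "k < Suc j - i \<longleftrightarrow> k < j - i \<or> k = j - i" for k using assms by auto
    moreover have "i + (j - i) = j" "1 \<le> j - i" using assms by auto
    ultimately show ?thesis by (metis Suc_eq_plus1)
  qed
  moreover have "set [i..<Suc j + 1] \<subseteq> X \<longleftrightarrow> set [i..<j + 1] \<subseteq> X \<and> Suc j \<in> X"
    using assms by (auto simp: le_Suc_eq)
  ultimately show ?thesis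
    unfolding cyclic_chain_def using assms by (simp only: distinct_upt length_upt) auto
qed

text \<open>Extending the chain by \<open>Suc j\<close> asks that going from \<open>f i\<close> to
  \<open>f j\<close> and on to \<open>f (Suc j)\<close> makes no full turn, i.e. that the two
  distances sum to at most \<open>t\<close>.\<close>

lemma chain_iff_sum_steps:
  assumes f: "f \<in> circle_maps n t" and "i < j" "j \<le> n"
  shows "cyclic_chain {0..n} (cyclic_order_of {0..n} (lex_key n f)) [i..<j + 1] \<longleftrightarrow>
    (\<Sum>k=i+1..j. circle_dist t (f (k - 1)) (f k)) \<le> t"
proof -
  let ?S = "\<lambda>j. \<Sum>k=i+1..j. circle_dist t (f (k - 1)) (f k)"
  let ?C = "\<lambda>j. cyclic_chain {0..n} (cyclic_order_of {0..n} (lex_key n f)) [i..<j + 1]"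
  \<comment> \<open>The induction also carries that, before a full turn, the steps add up to the
    distance between the endpoints.\<close>
  have "(?C j \<longleftrightarrow> ?S j \<le> t) \<and> (?S j \<le> t \<longrightarrow> ?S j = circle_dist t (f i) (f j))"
    using Suc_leI[OF assms(2)] assms(3)
  proof (induction j rule: dec_induct)
    case base
    have "?C (Suc i)" using base by (auto simp: cyclic_chain_def)
    moreover have "f i \<le> t" "f (Suc i) \<le> t" using f base by (auto intro: circle_maps_le)
    ultimately show ?case by (auto simp: circle_dist_def)
  next
    case (step j)
    have ij: "i < j" "Suc j \<le> n" using step by auto
    have S: "?S (Suc j) = ?S j + circle_dist t (f j) (f (Suc j))" using ij by simp
    have le: "f i \<le> t" "f j \<le> t" "f (Suc j) \<le> t" using f ij by (auto intro: circle_maps_le)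
    \<comment> \<open>As \<open>i < j < Suc j\<close>, ties are resolved in walking order:
      comparisons along the walk become weak, and the one closing up from \<open>Suc j\<close> to
      \<open>i\<close> stays strict.\<close>
    have *: "(i, j, Suc j) \<in> cyclic_order_of {0..n} (lex_key n f) \<longleftrightarrow>
      f i \<le> f j \<and> f j \<le> f (Suc j) \<or> f j \<le> f (Suc j) \<and> f (Suc j) < f i \<or> f (Suc j) < f i \<and> f i \<le> f j"
      using ij by (auto simp: cyclic_order_of_def lex_key_less_iff lex_less_def)
    have **: "(i, j, Suc j) \<in> cyclic_order_of {0..n} (lex_key n f) \<longleftrightarrow>
      circle_dist t (f i) (f j) + circle_dist t (f j) (f (Suc j)) \<le> t"
      unfolding * circle_dist_def using le by (auto split: if_splits)
    have ***: "circle_dist t (f i) (f j) + circle_dist t (f j) (f (Suc j)) \<le> t \<Longrightarrow>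
      circle_dist t (f i) (f j) + circle_dist t (f j) (f (Suc j)) = circle_dist t (f i) (f (Suc j))"
      unfolding circle_dist_def using le by (auto split: if_splits)
    show ?case
      using step ij S ** *** chain_Suc_iff[OF ij(1), of "{0..n}" "cyclic_order_of {0..n} (lex_key n f)"]
      by auto
  qed
  then show ?thesis by blast
qed

text \<open>The start is fixed at 0, and on \<open>t + 1\<close> points a position and the distance
  from it determine the next position.\<close>

lemma inj_on_steps: "inj_on (steps n t) (circle_maps n t)"
proof (rule inj_onI)
  fix f g assume f: "f \<in> circle_maps n t" and g: "g \<in> circle_maps n t" and eq: "steps n t f = steps n t g"
  have "f k = g k" if "k \<le> n" for k
    using that
  proof (induction k)
    case 0
    then show ?case using f g by (simp add: circle_maps_def)
  next
    case (Suc k)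
    have "steps n t f (Suc k) = steps n t g (Suc k)" using eq by simp
    then have "circle_dist t (g k) (f (Suc k)) = circle_dist t (g k) (g (Suc k))"
      using Suc by (simp add: steps_def)
    moreover have "f (Suc k) \<le> t" "g (Suc k) \<le> t" "g k \<le> t"
      using f g Suc by (auto intro: circle_maps_le)
    ultimately show ?case by (auto simp: circle_dist_def split: if_splits)
  qed
  moreover have "f \<in> extensional {0..n}" "g \<in> extensional {0..n}"
    using f g by (auto simp: circle_maps_def PiE_def)
  ultimately show "f = g" by (intro extensionalityI[of f "{0..n}" g]) auto
qed

lemma steps_image: "steps n t ` circle_maps n t = {1..n} \<rightarrow>\<^sub>E real ` {0..t}"
proof
  show "steps n t ` circle_maps n t \<subseteq> {1..n} \<rightarrow>\<^sub>E real ` {0..t}"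
  proof
    fix y assume "y \<in> steps n t ` circle_maps n t"
    then obtain f where f: "f \<in> circle_maps n t" and y: "y = steps n t f" by auto
    have "circle_dist t (f (k - 1)) (f k) \<le> t" if "k \<in> {1..n}" for k
      using circle_maps_le[OF f, of k] circle_maps_le[OF f, of "k - 1"] that
      by (auto simp: circle_dist_def)
    then show "y \<in> {1..n} \<rightarrow>\<^sub>E real ` {0..t}" by (auto simp: y steps_def)
  qed
  show "{1..n} \<rightarrow>\<^sub>E real ` {0..t} \<subseteq> steps n t ` circle_maps n t"
  proof
    fix y assume y: "y \<in> {1..n} \<rightarrow>\<^sub>E real ` {0..t}"
    define x where "x k = nat \<lfloor>y k\<rfloor>" for k
    have x: "y k = real (x k)" "x k \<le> t" if "k \<in> {1..n}" for k
      using PiE_mem[OF y that] by (auto simp: x_def)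
    \<comment> \<open>The walk with prescribed steps: partial sums reduced modulo
      \<open>t + 1\<close>.\<close>
    define f where "f = (\<lambda>k\<in>{0..n}. (\<Sum>l=1..k. x l) mod (t + 1))"
    have f: "f \<in> circle_maps n t"
      by (auto simp: circle_maps_def f_def less_Suc_eq_le[symmetric])
    have "circle_dist t (f (k - 1)) (f k) = x k" if k: "k \<in> {1..n}" for k
    proof -
      obtain m where m: "k = Suc m" using k by (cases k) auto
      have "f k = (f m + x k) mod (t + 1)"
        using k m by (simp add: f_def mod_simps)
      \<comment> \<open>Both summands are at most \<open>t\<close>, so the reduction subtracts
        \<open>t + 1\<close> at most once.\<close>
      also have "\<dots> = (if f m + x k \<le> t then f m + x k else f m + x k - (t + 1))"
        using circle_maps_le[OF f, of m] x[OF k] k m by (auto simp: mod_if)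
      finally show ?thesis
        using circle_maps_le[OF f, of m] x[OF k] k m by (auto simp: circle_dist_def)
    qed
    then have "steps n t f = y"
      using x y by (intro extensionalityI[of _ "{1..n}"]) (auto simp: steps_def PiE_def)
    with f show "y \<in> steps n t ` circle_maps n t" by blast
  qed
qed

lemma dilate_polytope_B_lattice:
  assumes "I \<subseteq> index_pairs n"
  shows "dilate n t (polytope_B I n) \<inter> ({1..n} \<rightarrow>\<^sub>E \<int>) =
    {y \<in> {1..n} \<rightarrow>\<^sub>E real ` {0..t}. \<forall>(i, j)\<in>I. (\<Sum>k=i+1..j. y k) \<le> real t}" (is "?L = ?R")
proof
  have I: "i < j" "j \<le> n" if "(i, j) \<in> I" for i j using assms that by (auto simp: index_pairs_def)
  show "?L \<subseteq> ?R"
  proof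
    fix y assume "y \<in> ?L"
    then obtain x where x: "x \<in> polytope_B I n" and y: "y = (\<lambda>k\<in>{1..n}. real t * x k)"
      and yi: "y \<in> {1..n} \<rightarrow>\<^sub>E \<int>" by (auto simp: dilate_def)
    have "y k \<in> real ` {0..t}" if k: "k \<in> {1..n}" for k
    proof -
      have "0 \<le> x k" "x k \<le> 1" using x k by (auto simp: polytope_B_def PiE_def Pi_def)
      then have b: "0 \<le> y k" "y k \<le> t" using k by (auto simp: y mult_left_le)
      moreover obtain z where z: "y k = of_int z" using PiE_mem[OF yi k] by (auto elim: Ints_cases)
      ultimately have "y k = real (nat z)" "nat z \<in> {0..t}" by auto
      then show ?thesis by blast
    qed
    moreover have "(\<Sum>k=i+1..j. y k) \<le> real t" if ij: "(i, j) \<in> I" for i j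
    proof -
      have "(\<Sum>k=i+1..j. y k) = real t * (\<Sum>k=i+1..j. x k)"
        unfolding sum_distrib_left using I[OF ij] by (intro sum.cong) (auto simp: y)
      also have "\<dots> \<le> real t * 1"
        using x ij by (intro mult_left_mono) (auto simp: polytope_B_def)
      finally show ?thesis by simp
    qed
    ultimately show "y \<in> ?R" using yi by auto
  qed
  show "?R \<subseteq> ?L"
  proof
    fix y assume y: "y \<in> ?R"
    \<comment> \<open>For \<open>t = 0\<close> this is the origin, since division by zero yields zero.\<close>
    define x where "x = (\<lambda>k\<in>{1..n}. y k / real t)"
    have mem: "\<exists>m\<le>t. y k = real m" if "k \<in> {1..n}" for k
      using y that by (auto simp: PiE_def Pi_def)
    have "x k \<in> {0..1}" if k: "k \<in> {1..n}" for k
      using mem[OF k] k by (auto simp: x_def divide_le_eq_1)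
    moreover have "(\<Sum>k=i+1..j. x k) \<le> 1" if ij: "(i, j) \<in> I" for i j
    proof -
      have "(\<Sum>k=i+1..j. x k) = (\<Sum>k=i+1..j. y k) / real t"
        unfolding sum_divide_distrib using I[OF ij] by (intro sum.cong) (auto simp: x_def)
      also have "\<dots> \<le> 1" using y ij by (auto simp: divide_le_eq_1)
      finally show ?thesis .
    qed
    ultimately have "x \<in> polytope_B I n" by (auto simp: polytope_B_def x_def)
    moreover have "y = (\<lambda>k\<in>{1..n}. real t * x k)"
      using y mem by (intro extensionalityI[of _ "{1..n}"]) (fastforce simp: x_def PiE_def)+
    moreover have "y \<in> {1..n} \<rightarrow>\<^sub>E \<int>"
      using y mem by (fastforce simp: PiE_def Pi_def)
    ultimately show "y \<in> ?L" by (auto simp: dilate_def)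
  qed
qed

section \<open>Grouping lattice points by cyclic order\<close>

text \<open>\<open>steps\<close> maps walks bijectively onto the lattice points of the dilated cube
  and turns the chain conditions into the inequalities of the polytope.\<close>

lemma ehrhart_polytope_B:
  assumes "I \<subseteq> index_pairs n"
  shows "ehrhart n (polytope_B I n) t =
    card {f \<in> circle_maps n t. cyclic_order_of {0..n} (lex_key n f) \<in> cyclic_orders_A I n}"
proof -
  let ?F = "{f \<in> circle_maps n t. cyclic_order_of {0..n} (lex_key n f) \<in> cyclic_orders_A I n}"
  have I: "i < j" "j \<le> n" if "(i, j) \<in> I" for i j using assms that by (auto simp: index_pairs_def)
  have A: "cyclic_order_of {0..n} (lex_key n f) \<in> cyclic_orders_A I n \<longleftrightarrow>
      (\<forall>(i, j)\<in>I. (\<Sum>k=i+1..j. steps n t f k) \<le> real t)" if f: "f \<in> circle_maps n t" for f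
  proof -
    have "zero_first n (lex_key n f)"
      using f by (intro zero_first_lex_key) (simp add: circle_maps_def)
    then have "total_cyclic_order_on {0..n} (cyclic_order_of {0..n} (lex_key n f))"
      by (intro total_cyclic_order_of) (simp add: zero_first_def)
    moreover have "cyclic_chain {0..n} (cyclic_order_of {0..n} (lex_key n f)) [i..<j + 1] \<longleftrightarrow>
        (\<Sum>k=i+1..j. steps n t f k) \<le> real t" if ij: "(i, j) \<in> I" for i j
    proof -
      have "(\<Sum>k=i+1..j. steps n t f k) = real (\<Sum>k=i+1..j. circle_dist t (f (k - 1)) (f k))"
        unfolding of_nat_sum using I[OF ij] by (intro sum.cong) (auto simp: steps_def)
      then show ?thesis
        using chain_iff_sum_steps[OF f I[OF ij]] by (simp only: of_nat_le_iff)
    qed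
    ultimately show ?thesis unfolding cyclic_orders_A_def by blast
  qed
  have "dilate n t (polytope_B I n) \<inter> ({1..n} \<rightarrow>\<^sub>E \<int>) = steps n t ` ?F"
    unfolding dilate_polytope_B_lattice[OF assms] steps_image[symmetric] using A by auto
  moreover have "inj_on (steps n t) ?F"
    by (rule inj_on_subset[OF inj_on_steps]) auto
  ultimately show ?thesis
    by (simp add: ehrhart_def card_image)
qed

text \<open>A walk induces \<open>\<pi>\<close> exactly when its lexicographic keys increase along
  the word of \<open>\<pi>\<close>, which reduces the count for each order to
  \<open>lex_sorted_maps\<close>.\<close>

lemma fibre_eq_lex_sorted_maps:
  assumes "total_cyclic_order_on {0..n} \<pi>" "n \<ge> 1"
  shows "{f \<in> circle_maps n t. cyclic_order_of {0..n} (lex_key n f) = \<pi>} =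
      lex_sorted_maps (cyclic_word n \<pi>) t"
    and "length (cyclic_word n \<pi>) = n + 1" and "distinct (cyclic_word n \<pi>)"
proof -
  obtain p where p: "zero_first n p" and \<pi>: "\<pi> = cyclic_order_of {0..n} p"
    using total_cyclic_order_labelling[OF assms(1)] .
  let ?w = "cyclic_word n \<pi>"
  have set: "set ?w = {0..n}" and sorted: "sorted_wrt (<) (map p ?w)"
    using cyclic_word_cyclic_order_of[OF p assms(2)] by (simp_all add: \<pi>)
  have w: "length ?w = n + 1" "?w ! 0 = 0" and chain: "cyclic_chain {0..n} \<pi> ?w"
    using chain_iff_sorted[OF p assms(2), of ?w] set sorted by (simp_all add: \<pi>)
  show "length ?w = n + 1" "distinct ?w" using w chain by (auto simp: cyclic_chain_def)
  have hd: "hd ?w = 0" using w by (cases ?w) auto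
  have "cyclic_order_of {0..n} (lex_key n f) = \<pi> \<longleftrightarrow> sorted_wrt (lex_less f) ?w" if f0: "f 0 = 0" for f
  proof -
    have "sorted_wrt (lex_less f) ?w \<longleftrightarrow> sorted_wrt (<) (map (lex_key n f) ?w)"
      unfolding sorted_wrt_map using set by (intro sorted_wrt_cong_on_set) (auto simp: lex_key_less_iff)
    \<comment> \<open>Forwards, two labellings increasing along the same word induce the same order.
      Backwards, the word is a chain for the order induced by the keys, so the keys sort it.\<close>
    also have "\<dots> \<longleftrightarrow> cyclic_order_of {0..n} (lex_key n f) = \<pi>"
      using chain_iff_sorted[OF zero_first_lex_key[of f n, OF f0] assms(2), of ?w] w chain
        cyclic_order_of_eqI[OF _ sorted, of "lex_key n f"] set \<pi> by auto
    finally show ?thesis by simp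
  qed
  then show "{f \<in> circle_maps n t. cyclic_order_of {0..n} (lex_key n f) = \<pi>} = lex_sorted_maps ?w t"
    by (auto simp: circle_maps_def lex_sorted_maps_def set hd)
qed

theorem theorem2p9:
  fixes n :: nat and I :: "(nat \<times> nat) set"
  assumes "n \<ge> 1" and "I \<subseteq> index_pairs n"
  shows "ehrhart_hstar n (polytope_B I n) = (\<Sum>\<pi>\<in>cyclic_orders_A I n. fps_X ^ des (cyclic_word n \<pi>))"
proof -
  let ?A = "cyclic_orders_A I n"
  have tot: "total_cyclic_order_on {0..n} \<pi>" if "\<pi> \<in> ?A" for \<pi>
    using that by (auto simp: cyclic_orders_A_def)
  have "?A \<subseteq> Pow ({0..n} \<times> {0..n} \<times> {0..n})"
    using tot unfolding total_cyclic_order_on_def cyclic_order_on_def by blast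
  then have fin: "finite ?A" by (rule finite_subset) simp
  have "ehrhart n (polytope_B I n) t = (\<Sum>\<pi>\<in>?A. card (lex_sorted_maps (cyclic_word n \<pi>) t))" for t
  proof -
    \<comment> \<open>Each admissible walk induces exactly one order, so the fibres are
      disjoint.\<close>
    have "ehrhart n (polytope_B I n) t =
        card (\<Union>\<pi>\<in>?A. {f \<in> circle_maps n t. cyclic_order_of {0..n} (lex_key n f) = \<pi>})"
      unfolding ehrhart_polytope_B[OF assms(2)] by (rule arg_cong[where f = card]) auto
    also have "\<dots> = (\<Sum>\<pi>\<in>?A. card {f \<in> circle_maps n t. cyclic_order_of {0..n} (lex_key n f) = \<pi>})"
      by (rule card_UN_disjoint[OF fin]) (auto simp: finite_circle_maps)
    also have "\<dots> = (\<Sum>\<pi>\<in>?A. card (lex_sorted_maps (cyclic_word n \<pi>) t))"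
      by (intro sum.cong refl) (simp add: fibre_eq_lex_sorted_maps(1)[OF tot assms(1)])
    finally show ?thesis .
  qed
  then have "Abs_fps (\<lambda>t. int (ehrhart n (polytope_B I n) t)) =
      (\<Sum>\<pi>\<in>?A. Abs_fps (\<lambda>t. int (card (lex_sorted_maps (cyclic_word n \<pi>) t))))"
    by (intro fps_ext) (simp add: fps_sum_nth)
  then have "ehrhart_hstar n (polytope_B I n) =
      (\<Sum>\<pi>\<in>?A. (1 - fps_X) ^ (n + 1) * Abs_fps (\<lambda>t. int (card (lex_sorted_maps (cyclic_word n \<pi>) t))))"
    by (simp add: ehrhart_hstar_def sum_distrib_left)
  also have "\<dots> = (\<Sum>\<pi>\<in>?A. fps_X ^ des (cyclic_word n \<pi>))"
  \<comment> \<open>Every word has length \<open>n + 1\<close>, so the prefactor cancels the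
    denominator of each summand exactly.\<close>
  proof (rule sum.cong[OF refl])
    fix \<pi> assume "\<pi> \<in> ?A"
    note w = fibre_eq_lex_sorted_maps(2,3)[OF tot[OF this] assms(1)]
    then have "cyclic_word n \<pi> \<noteq> []" by auto
    from lex_sorted_maps_fps[OF this w(2)]
    show "(1 - fps_X) ^ (n + 1) * Abs_fps (\<lambda>t. int (card (lex_sorted_maps (cyclic_word n \<pi>) t))) =
        fps_X ^ des (cyclic_word n \<pi>)" by (simp only: w(1))
  qed
  finally show ?thesis .
qed

end
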